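(* Let $f$ be a transcendental entire function such that there exists $r>0$ with $m^n(r)\to\infty$ as $n\to\infty$. Then the set $V^{+}(f)$, and also the set $I^{+}(f)$, is a weak spider's web.
   Context: For the entire function $f$: $m(r)=\min_{|z|=r}|f(z)|$, $\widetilde m(r)=\max_{0\le s\le r}m(s)$; $m^n,\widetilde m^{\,n},f^n$ denote $n$th iterates; $\mathbb{N}=\{1,2,\dots\}$, $\mathbb{N}_0=\mathbb{N}\cup\{0\}$. $I^{+}(f)$ is the set of points $z\in\mathbb{C}$ for which the sequence $(f^n(z))$ is unbounded. If there exists $r>0$ with $m^n(r)\to\infty$, then there is $R>0$ such that $\widetilde m(r)>r$ for $r\ge R$, and $$V^{+}(f)=\bigcup_{\ell\in\mathbb{N}_0}f^{-\ell}(V_R^{+}(f)),\qquad V_R^{+}(f)=\{z:\exists\,(n_j)\text{ such that }|f^{n_j}(z)|\ge\widetilde m^{\,n_j}(R),\text{ for }j\in\mathbb{N}\},$$ for any such $R$, where $(n_j)$ is a strictly increasing sequence of positive integers that may depend on $z$; $V^{+}(f)$ is independent of the choice of such $R$. A weak spider's web is a connected subset of $\mathbb{C}$ whose complement contains no unbounded closed connected sets. *)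

theory Defs
  imports "HOL-Complex_Analysis.Complex_Analysis"
begin

definition transcendental_entire :: "(complex \<Rightarrow> complex) \<Rightarrow> bool" where
  "transcendental_entire f \<longleftrightarrow>
     f holomorphic_on UNIV \<and> \<not> (\<exists>p :: complex poly. \<forall>z. f z = poly p z)"

text \<open>The infimum and the supremum below are a minimum and a maximum when \<open>f\<close> is continuous and
  \<open>r \<ge> 0\<close>: see \<open>min_modulus_attained\<close> and \<open>max_min_modulus_attained\<close>. For \<open>r < 0\<close> the index sets
  are empty and the values are meaningless; iteration started at a point \<open>r \<ge> 0\<close> never
  leaves \<open>{0..}\<close>.\<close>

definition min_modulus :: "(complex \<Rightarrow> complex) \<Rightarrow> real \<Rightarrow> real" where
  "min_modulus f r = (INF z\<in>sphere 0 r. norm (f z))"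

definition max_min_modulus :: "(complex \<Rightarrow> complex) \<Rightarrow> real \<Rightarrow> real" where
  "max_min_modulus f r = (SUP s\<in>{0..r}. min_modulus f s)"

definition I_plus :: "(complex \<Rightarrow> complex) \<Rightarrow> complex set" where
  "I_plus f = {z. \<not> bounded (range (\<lambda>n. (f ^^ n) z))}"

definition admissible_radius :: "(complex \<Rightarrow> complex) \<Rightarrow> real \<Rightarrow> bool" where
  "admissible_radius f R \<longleftrightarrow> R > 0 \<and> (\<forall>r\<ge>R. max_min_modulus f r > r)"

definition V_plus_R :: "(complex \<Rightarrow> complex) \<Rightarrow> real \<Rightarrow> complex set" where
  "V_plus_R f R = {z. \<exists>n :: nat \<Rightarrow> nat. strict_mono n \<and> (\<forall>j. n j > 0) \<and>
      (\<forall>j. norm ((f ^^ n j) z) \<ge> (max_min_modulus f ^^ n j) R)}"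

text \<open>The set \<open>V\<^sup>+(f)\<close>, computed with the radius \<open>R\<close>. It is only meaningful for admissible \<open>R\<close>,
  and then does not depend on \<open>R\<close>. Admissible radii exist whenever some orbit of
  \<open>min_modulus f\<close> tends to infinity: see \<open>ex_admissible_radius\<close>.\<close>

definition V_plus :: "(complex \<Rightarrow> complex) \<Rightarrow> real \<Rightarrow> complex set" where
  "V_plus f R = (\<Union>l::nat. (f ^^ l) -` V_plus_R f R)"

definition weak_spiders_web :: "complex set \<Rightarrow> bool" where
  "weak_spiders_web E \<longleftrightarrow> connected E \<and>
     \<not> (\<exists>C. C \<subseteq> - E \<and> closed C \<and> connected C \<and> \<not> bounded C)"

lemma min_modulus_attained:
  assumes "continuous_on UNIV f" "r \<ge> 0"
  shows "\<exists>z\<in>sphere 0 r. min_modulus f r = norm (f z) \<and> (\<forall>w\<in>sphere 0 r. norm (f z) \<le> norm (f w))"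
proof -
  have "continuous_on (sphere 0 r) (\<lambda>z. norm (f z))"
    by (intro continuous_on_norm continuous_on_subset[OF assms(1)]) auto
  moreover have "sphere (0::complex) r \<noteq> {}"
    using assms(2) by simp
  ultimately obtain z where z: "z \<in> sphere 0 r" "\<forall>w\<in>sphere 0 r. norm (f z) \<le> norm (f w)"
    using continuous_attains_inf[of "sphere (0::complex) r" "\<lambda>z. norm (f z)"] compact_sphere by blast
  have "min_modulus f r = norm (f z)"
    unfolding min_modulus_def by (rule cInf_eq_minimum) (use z in auto)
  with z show ?thesis by blast
qed

lemma min_modulus_nonneg:
  assumes "continuous_on UNIV f" "r \<ge> 0"
  shows "min_modulus f r \<ge> 0"
  using min_modulus_attained[OF assms] by auto

lemma continuous_on_min_modulus:
  assumes "continuous_on UNIV f"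
  shows "continuous_on {0..} (min_modulus f)"
proof -
  have key: "min_modulus f s < min_modulus f r + e"
    if rs: "r \<ge> 0" "s \<ge> 0" "r \<le> B" "s \<le> B" and d: "\<bar>r - s\<bar> < d"
      and unif: "\<And>x y. x \<in> cball 0 B \<Longrightarrow> y \<in> cball 0 B \<Longrightarrow> dist y x < d \<Longrightarrow> dist (f y) (f x) < e"
    for r s B d e
  proof -
    obtain z where z: "norm z = r" "min_modulus f r = norm (f z)"
      using min_modulus_attained[OF assms \<open>r \<ge> 0\<close>] by auto
    obtain w where w: "norm w = s" "dist w z = \<bar>r - s\<bar>"
    proof (cases "r = 0")
      case True
      then show ?thesis using z rs that[of "of_real s"] by (auto simp: dist_norm)
    next
      case False
      let ?w = "(s / r) *\<^sub>R z"
      have "norm ?w = s" using False z rs by simp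
      moreover have "?w - z = (s / r - 1) *\<^sub>R z" by (simp add: algebra_simps)
      then have "norm (?w - z) = \<bar>s / r - 1\<bar> * r" using z by simp
      then have "dist ?w z = \<bar>r - s\<bar>"
        using False rs by (simp add: dist_norm abs_if field_simps split: if_splits)
      ultimately show ?thesis using that by blast
    qed
    have "dist (f w) (f z) < e"
      by (rule unif) (use z w rs d in auto)
    then have "norm (f w) < norm (f z) + e"
      by (smt (verit) dist_norm norm_triangle_sub)
    moreover have "min_modulus f s \<le> norm (f w)"
      using min_modulus_attained[OF assms \<open>s \<ge> 0\<close>] w by fastforce
    ultimately show ?thesis using z by linarith
  qed
  show ?thesis
    unfolding continuous_on_iff
  proof (intro ballI allI impI)
    fix r e :: real assume r: "r \<in> {0..}" and e: "e > 0"
    have "uniformly_continuous_on (cball 0 (r + 1)) f"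
      by (intro compact_uniformly_continuous continuous_on_subset[OF assms]) auto
    then obtain d where d: "d > 0"
      "\<And>x y. x \<in> cball 0 (r+1) \<Longrightarrow> y \<in> cball 0 (r+1) \<Longrightarrow> dist y x < d \<Longrightarrow> dist (f y) (f x) < e"
      using e unfolding uniformly_continuous_on_def by metis
    show "\<exists>d>0. \<forall>s\<in>{0..}. dist s r < d \<longrightarrow> dist (min_modulus f s) (min_modulus f r) < e"
    proof (intro exI[of _ "min d 1"] conjI ballI impI)
      show "min d 1 > 0" using d by simp
      fix s :: real assume s: "s \<in> {0..}" "dist s r < min d 1"
      have "min_modulus f s < min_modulus f r + e"
        by (rule key[where B = "r+1" and d = d]) (use r s d in \<open>auto simp: dist_real_def\<close>)
      moreover have "min_modulus f r < min_modulus f s + e"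
        by (rule key[where B = "r+1" and d = d]) (use r s d in \<open>auto simp: dist_real_def\<close>)
      ultimately show "dist (min_modulus f s) (min_modulus f r) < e"
        by (auto simp: dist_real_def)
    qed
  qed
qed

lemma max_min_modulus_attained:
  assumes "continuous_on UNIV f" "r \<ge> 0"
  shows "\<exists>s\<in>{0..r}. max_min_modulus f r = min_modulus f s
           \<and> (\<forall>t\<in>{0..r}. min_modulus f t \<le> min_modulus f s)"
proof -
  have "continuous_on {0..r} (min_modulus f)"
    by (rule continuous_on_subset[OF continuous_on_min_modulus[OF assms(1)]]) auto
  then obtain s where s: "s \<in> {0..r}" "\<forall>t\<in>{0..r}. min_modulus f t \<le> min_modulus f s"
    using continuous_attains_sup[of "{0..r}" "min_modulus f"] assms(2) by auto
  have "max_min_modulus f r = min_modulus f s"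
    unfolding max_min_modulus_def by (rule cSup_eq_maximum) (use s in auto)
  with s show ?thesis by blast
qed

lemma ex_admissible_radius:
  assumes "continuous_on UNIV f" "r > 0"
    and lim: "filterlim (\<lambda>n. (min_modulus f ^^ n) r) at_top sequentially"
  shows "\<exists>R. admissible_radius f R"
proof (rule ccontr)
  assume "\<not> ?thesis"
  then obtain s where s: "s \<ge> r" "max_min_modulus f s \<le> s"
    using assms(2) unfolding admissible_radius_def by (meson not_le)
  have "(min_modulus f ^^ n) r \<in> {0..s}" for n
  proof (induction n)
    case 0
    then show ?case using s assms(2) by simp
  next
    case (Suc n)
    then show ?case
      using max_min_modulus_attained[OF assms(1), of s] min_modulus_nonneg[OF assms(1)] s assms(2)
      by fastforce
  qed
  moreover have "eventually (\<lambda>n. (min_modulus f ^^ n) r > s) sequentially"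
    using lim by (simp add: filterlim_at_top_dense)
  ultimately show False
    by (auto simp: eventually_sequentially not_le[symmetric])
qed

end

theory Submission
  imports Defs
begin

text \<open>Write \<open>a\<^sub>n\<close> for the iterates of \<open>max_min_modulus f\<close> at \<open>R\<close>. Between \<open>a\<^sub>n\<close> and \<open>a\<^sub>n\<^sub>+\<^sub>1\<close>
  there is a radius at which the minimum modulus is \<open>a\<^sub>n\<^sub>+\<^sub>2\<close>, so once an iterated image of a continuum
  crosses the annulus from \<open>a\<^sub>n\<close> to \<open>a\<^sub>n\<^sub>+\<^sub>1\<close>, the next image reaches \<open>a\<^sub>n\<^sub>+\<^sub>2\<close>; if moreover it always
  comes back inside \<open>a\<^sub>n\<close> it crosses for ever. Passing to components on which the \<open>n\<close>th image stays
  outside \<open>a\<^sub>n\<close> then yields a point of the continuum in \<open>V\<^sup>+(f)\<close>. An unbounded closed connected set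
  contains such a continuum because the minimum modulus is unbounded. A continuum separating two
  points of \<open>V\<^sup>+(f)\<close> or of \<open>I\<^sup>+(f)\<close> is such a continuum by the maximum principle.\<close>

section \<open>Continua and components\<close>

text \<open>By Sura-Bura, \<open>C\<close> has a neighbourhood \<open>Q\<close> inside
  \<open>U\<close> that is clopen in \<open>S \<inter> D\<close>. Since
  \<open>U \<subseteq> D\<close>, \<open>Q\<close> is even clopen in the connected set
  \<open>S\<close>, hence equal to it.\<close>

lemma component_boundary_bumping:
  fixes S :: "'a::euclidean_space set"
  assumes "connected S" "compact (S \<inter> D)" "open U" "U \<subseteq> D" "C \<in> components (S \<inter> D)" "C \<subseteq> U"
  shows "S \<subseteq> U"
proof -
  have "compact C"
    using assms(2,5) by (metis closed_components compact_components)
  then obtain Q where Q: "openin (top_of_set (S \<inter> D)) Q" "compact Q" "C \<subseteq> Q" "Q \<subseteq> U"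
    using Sura_Bura_clopen_subset[of "S \<inter> D" C U] assms compact_imp_closed
      closed_imp_locally_compact by metis
  then obtain W where W: "open W" "Q = S \<inter> D \<inter> W"
    by (auto simp: openin_open)
  have "Q = S \<inter> (U \<inter> W)"
    using W Q assms(4) by blast
  then have "openin (top_of_set S) Q"
    using W assms(3) by (auto simp: openin_open)
  moreover have "closedin (top_of_set S) Q"
    using Q W by (metis Int_assoc closed_subset compact_imp_closed inf_le1)
  moreover have "Q \<noteq> {}"
    using Q assms(5) in_components_nonempty by blast
  ultimately show ?thesis
    using assms(1) Q connected_clopen by blast
qed

section \<open>Continua whose images cross every annulus\<close>

text \<open>Isolates the topology: \<open>F n\<close> will be the modulus of an iterate of the
  function and \<open>a\<close> the orbit of \<open>R\<close>. The minimum modulus enters only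
  through \<open>cross\<close>.\<close>

locale crossing =
  fixes F :: "nat \<Rightarrow> 'a::euclidean_space \<Rightarrow> real" and a :: "nat \<Rightarrow> real"
  assumes cont: "\<And>n. continuous_on UNIV (F n)"
    and less_Suc: "\<And>n. a n < a (Suc n)"
    and cross: "\<And>n C. connected C \<Longrightarrow> \<exists>x\<in>C. F n x \<le> a n \<Longrightarrow> \<exists>x\<in>C. F n x \<ge> a (Suc n) \<Longrightarrow>
          \<exists>x\<in>C. F (Suc n) x \<ge> a (Suc (Suc n))"
begin

definition keeps_crossing :: "nat \<Rightarrow> 'a set \<Rightarrow> bool" where
  "keeps_crossing N C \<longleftrightarrow> compact C \<and> connected C \<and>
     (\<forall>n\<ge>N. (\<exists>x\<in>C. F n x \<le> a n) \<and> (\<exists>x\<in>C. F n x \<ge> a (Suc n)))"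

text \<open>High points reproduce themselves: a low and a high point at time \<open>n\<close> give,
  by \<open>cross\<close>, a high point at time \<open>Suc n\<close>. So one initial high point
  suffices.\<close>

lemma keeps_crossingI:
  assumes "compact C" "connected C" "\<And>n. n \<ge> N \<Longrightarrow> \<exists>x\<in>C. F n x \<le> a n"
    and "\<exists>x\<in>C. F N x \<ge> a (Suc N)"
  shows "keeps_crossing N C"
proof -
  have "\<exists>x\<in>C. F n x \<ge> a (Suc n)" if "n \<ge> N" for n
    using that by (induction rule: dec_induct) (use assms cross in auto)
  then show ?thesis
    using assms unfolding keeps_crossing_def by auto
qed

text \<open>A component lying strictly above the level would, by boundary bumping, force all of
  \<open>G\<close> above it, against the low point of \<open>G\<close> at time
  \<open>n\<close>.\<close>

lemma keeps_crossing_component: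
  assumes G: "keeps_crossing N G" "n \<ge> N" and C: "C \<in> components (G \<inter> {x. F n x \<ge> a n})"
  shows "compact C" "\<exists>x\<in>C. F n x \<le> a n"
proof -
  have "closed {x. F n x \<ge> a n}"
    using cont by (intro closed_Collect_le) auto
  then have cpt: "compact (G \<inter> {x. F n x \<ge> a n})"
    using G unfolding keeps_crossing_def by (metis compact_Int_closed)
  then show "compact C"
    using C by (metis compact_components)
  have op: "open {x. F n x > a n}"
    using cont by (intro open_Collect_less) auto
  show "\<exists>x\<in>C. F n x \<le> a n"
  proof (rule ccontr)
    assume "\<not> ?thesis"
    then have "C \<subseteq> {x. F n x > a n}"
      by (auto simp: not_le)
    then have "G \<subseteq> {x. F n x > a n}"
      using component_boundary_bumping[OF _ cpt op _ C] G less_imp_le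
      unfolding keeps_crossing_def by blast
    then show False
      using G unfolding keeps_crossing_def by (meson mem_Collect_eq not_le subsetD)
  qed
qed

text \<open>One step of the nested construction in \<open>keeps_crossing_imp_frequently\<close>.
  That proof is by contradiction, which is where \<open>never\<close> comes from; \<open>M\<close>
  pushes the chosen times to infinity.\<close>

lemma keeps_crossing_refine:
  assumes G: "keeps_crossing N G" and never: "\<And>x. x \<in> G \<Longrightarrow> \<exists>M. \<forall>n\<ge>M. F n x < a n"
  shows "\<exists>n>M. \<exists>C\<subseteq>G. keeps_crossing n C \<and> (\<forall>x\<in>C. F n x \<ge> a n)"
proof (rule ccontr)
  assume neg: "\<not> ?thesis"
  define M' where "M' = max (Suc M) N"
  define K where "K n w = connected_component_set (G \<inter> {x. F n x \<ge> a n}) w" for n w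
  have base: "\<exists>w\<in>G. F M' w \<ge> a (Suc M')"
    using G unfolding keeps_crossing_def M'_def by simp
  then obtain w where w: "w \<in> G" "F M' w \<ge> a (Suc M')"
    by blast
  \<comment> \<open>A component that stops crossing lies, at the time of failure, inside a component of
    the next level set, so \<open>w\<close> is outside \<open>a\<^sub>n\<close> infinitely often.\<close>
  define P where "P n \<longleftrightarrow> n \<ge> M' \<and> F n w \<ge> a n \<and> (\<exists>x\<in>K n w. F n x \<ge> a (Suc n))" for n
  have "P M'"
    using w less_Suc[of M'] unfolding P_def K_def
    by (intro conjI bexI[of _ w]) auto
  have step: "\<exists>n'>n. P n'" if "P n" for n
  proof -
    have n: "n \<ge> N" "n > M" "n \<ge> M'" "F n w \<ge> a n"
      using that unfolding P_def M'_def by auto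
    have wK: "w \<in> K n w"
      using w n unfolding K_def by auto
    have KC: "K n w \<in> components (G \<inter> {x. F n x \<ge> a n})"
      using w n unfolding K_def components_def by auto
    have KG: "K n w \<subseteq> G" "\<forall>x\<in>K n w. F n x \<ge> a n" "connected (K n w)"
      using in_components_subset[OF KC] in_components_connected[OF KC] by auto
    have "\<not> keeps_crossing n (K n w)"
      using neg n KG by blast
    moreover have "compact (K n w)" "\<exists>x\<in>K n w. F n x \<ge> a (Suc n)"
      using keeps_crossing_component[OF G n(1) KC] that unfolding P_def by auto
    ultimately obtain m where m: "m \<ge> n" "\<not> (\<exists>x\<in>K n w. F m x \<le> a m)"
      using keeps_crossingI[of "K n w" n] KG(3) by blast
    \<comment> \<open>Taking the first failure leaves low points at all times from \<open>n\<close>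
      up to \<open>n'\<close>, so \<open>cross\<close> can be iterated to produce a high point at
      time \<open>n'\<close> itself.\<close>
    define n' where "n' = (LEAST m. m \<ge> n \<and> \<not> (\<exists>x\<in>K n w. F m x \<le> a m))"
    have n': "n' \<ge> n" "\<not> (\<exists>x\<in>K n w. F n' x \<le> a n')"
      using LeastI[of "\<lambda>m. m \<ge> n \<and> \<not> (\<exists>x\<in>K n w. F m x \<le> a m)" m] m unfolding n'_def by auto
    have before: "\<exists>x\<in>K n w. F m x \<le> a m" if "n \<le> m" "m < n'" for m
      using not_less_Least[of m "\<lambda>m. m \<ge> n \<and> \<not> (\<exists>x\<in>K n w. F m x \<le> a m)"] that
      unfolding n'_def by auto
    have reach: "\<exists>x\<in>K n w. F m x \<ge> a (Suc m)" if "n \<le> m" "m \<le> n'" for m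
      using that
    proof (induction rule: dec_induct)
      case base
      then show ?case using \<open>P n\<close> unfolding P_def by auto
    next
      case (step m)
      then show ?case using cross[OF KG(3) before[of m]] by auto
    qed
    \<comment> \<open>There is no failure at time \<open>n\<close>: the component touches the level
      \<open>a n\<close>.\<close>
    have "n' > n"
      using n' keeps_crossing_component(2)[OF G n(1) KC] by (metis le_neq_implies_less)
    moreover have "K n w \<subseteq> K n' w"
      unfolding K_def[of n']
      by (rule connected_component_maximal[OF wK KG(3)]) (use n' KG in \<open>auto simp: not_le\<close>)
    then have "P n'"
      unfolding P_def using n n' wK reach[of n'] by (auto simp: not_le intro: less_imp_le)
    ultimately show ?thesis by blast
  qed
  obtain B where B: "\<forall>n\<ge>B. F n w < a n"
    using never w by blast
  have "\<exists>n\<ge>k. P n" for k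
    by (induction k) (use \<open>P M'\<close> step in \<open>auto, meson Suc_leI le_less_trans\<close>)
  then show False
    using B unfolding P_def by (meson not_le)
qed

text \<open>Refining repeatedly gives nested continua, each outside its level at its own time. These
  times are unbounded, so a common point is outside infinitely often.\<close>

lemma keeps_crossing_imp_frequently:
  assumes G: "keeps_crossing N G"
  shows "\<exists>x\<in>G. \<forall>M. \<exists>n\<ge>M. F n x \<ge> a n"
proof (rule ccontr)
  assume "\<not> ?thesis"
  then have never: "\<And>x. x \<in> G \<Longrightarrow> \<exists>M. \<forall>n\<ge>M. F n x < a n"
    by (meson not_le)
  \<comment> \<open>The pair \<open>p\<close> consists of a time, at least \<open>k\<close>, and a
    continuum lying outside the level at that time.\<close>
  define P where "P k p \<longleftrightarrow> fst p \<ge> k \<and> snd p \<subseteq> G \<and> keeps_crossing (fst p) (snd p) \<and>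
      (\<forall>x\<in>snd p. F (fst p) x \<ge> a (fst p))" for k and p :: "nat \<times> 'a set"
  have "\<exists>p. P 0 p"
    using keeps_crossing_refine[OF G never, of 0] unfolding P_def by auto
  moreover have "\<exists>q. P (Suc k) q \<and> snd q \<subseteq> snd p" if p: "P k p" for k p
  proof -
    obtain n C where "n > k" "C \<subseteq> snd p" "keeps_crossing n C" "\<forall>x\<in>C. F n x \<ge> a n"
      using keeps_crossing_refine[of "fst p" "snd p" k] p never unfolding P_def by blast
    then show ?thesis
      using p unfolding P_def by (intro exI[of _ "(n, C)"]) auto
  qed
  ultimately obtain s where s: "\<And>k. P k (s k)" "\<And>k. snd (s (Suc k)) \<subseteq> snd (s k)"
    using dependent_nat_choice[of P "\<lambda>_ p q. snd q \<subseteq> snd p"] by metis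
  have "(\<Inter>k. snd (s k)) \<noteq> {}"
  proof (rule compact_nest)
    show "compact (snd (s k))" "snd (s k) \<noteq> {}" for k
      using s(1)[of k] unfolding P_def keeps_crossing_def by auto
    show "snd (s n) \<subseteq> snd (s m)" if "m \<le> n" for m n
      using lift_Suc_antimono_le[of "\<lambda>k. snd (s k)"] s(2) that by blast
  qed
  then obtain x where x: "\<And>k. x \<in> snd (s k)"
    by auto
  then have "x \<in> G"
    using s(1)[of 0] unfolding P_def by auto
  then obtain M where M: "\<forall>n\<ge>M. F n x < a n"
    using never by blast
  have "fst (s M) \<ge> M" "F (fst (s M)) x \<ge> a (fst (s M))"
    using s(1)[of M] x[of M] unfolding P_def by auto
  then show False
    using M by (meson not_le)
qed

text \<open>The form used later: a single point \<open>p\<close> serves as low point at all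
  times.\<close>

lemma continuum_frequently:
  assumes "compact C" "connected C" "p \<in> C" "\<And>n. n \<ge> N \<Longrightarrow> F n p \<le> a n"
    and "q \<in> C" "F N q \<ge> a (Suc N)"
  shows "\<exists>x\<in>C. \<forall>M. \<exists>n\<ge>M. F n x \<ge> a n"
  using assms by (intro keeps_crossing_imp_frequently[of N] keeps_crossingI) auto

end

section \<open>A criterion for weak spiders' webs\<close>

text \<open>If \<open>E\<close> were disconnected, some closed connected set \<open>C\<close>
  missing \<open>E\<close> would separate two points of \<open>E\<close>. By \<open>unb\<close> it
  is bounded, so one of its bounded complementary components meets \<open>E\<close>, and
  \<open>sep\<close> gives a contradiction.\<close>

lemma weak_spiders_webI:
  assumes unb: "\<And>K. closed K \<Longrightarrow> connected K \<Longrightarrow> \<not> bounded K \<Longrightarrow> K \<inter> E \<noteq> {}"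
    and sep: "\<And>C G. compact C \<Longrightarrow> connected C \<Longrightarrow> G \<in> components (- C) \<Longrightarrow> bounded G \<Longrightarrow>
        G \<inter> E \<noteq> {} \<Longrightarrow> C \<inter> E \<noteq> {}"
  shows "weak_spiders_web E"
proof -
  have "connected E"
  proof (rule ccontr)
    assume "\<not> connected E"
    then obtain A B where AB: "open A" "open B" "E \<subseteq> A \<union> B" "A \<inter> B \<inter> E = {}"
        "A \<inter> E \<noteq> {}" "B \<inter> E \<noteq> {}"
      unfolding connected_def by blast
    \<comment> \<open>\<open>A\<close> and \<open>B\<close> are disjoint only on \<open>E\<close>;
      complete normality replaces them by open sets that are really disjoint.\<close>
    have "(A \<inter> E) \<inter> closure (B \<inter> E) = {}" "(B \<inter> E) \<inter> closure (A \<inter> E) = {}"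
      using AB open_Int_closure_eq_empty[of A "B \<inter> E"] open_Int_closure_eq_empty[of B "A \<inter> E"]
      by blast+
    then obtain U V where UV: "U \<inter> V = {}" "open U" "open V" "A \<inter> E \<subseteq> U" "B \<inter> E \<subseteq> V"
      using separation_closures by metis
    then have EUV: "E \<subseteq> U \<union> V"
      using AB by blast
    obtain x y where xy: "x \<in> E" "x \<in> U" "y \<in> E" "y \<in> V"
      using AB UV by blast
    have "\<not> connected_component (U \<union> V) x y"
    proof
      assume "connected_component (U \<union> V) x y"
      then obtain T where "connected T" "T \<subseteq> U \<union> V" "x \<in> T" "y \<in> T"
        unfolding connected_component_def by blast
      then show False
        using connectedD[of T U V] UV xy by blast
    qed
    moreover have "closed (- (U \<union> V))"
      using UV by auto
    \<comment> \<open>If a closed set separates two points, then so does one of its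
      components.\<close>
    ultimately obtain C where C: "C \<in> components (- (U \<union> V))" "\<not> connected_component (- C) x y"
      using separation_by_component_closed_pointwise[of "- (U \<union> V)" x y] by (auto simp del: Compl_Un)
    have CE: "C \<inter> E = {}"
      using in_components_subset[OF C(1)] EUV by blast
    have conn: "connected C" and "closed C"
      using C(1) \<open>closed (- (U \<union> V))\<close> in_components_connected closed_components by blast+
    with unb CE have "bounded C"
      by blast
    with \<open>closed C\<close> have "compact C"
      by (simp add: compact_eq_bounded_closed)
    \<comment> \<open>The complement of a bounded set in the plane has at most one unbounded
      component, so \<open>x\<close> and \<open>y\<close> cannot both lie in unbounded
      components.\<close>
    have "\<exists>z\<in>E. z \<in> - C \<and> bounded (connected_component_set (- C) z)"
      using C(2) CE xy \<open>bounded C\<close> cobounded_unique_unbounded_component[of "- C" x y]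
      by (metis Compl_iff DIM_complex IntI connected_component_eq_eq double_compl empty_iff
          order_refl)
    then obtain z where z: "z \<in> E" "z \<in> - C" "bounded (connected_component_set (- C) z)"
      by blast
    then have "connected_component_set (- C) z \<in> components (- C)"
      "z \<in> connected_component_set (- C) z"
      by (auto simp: components_def)
    then show False
      using sep[OF \<open>compact C\<close> conn _ z(3)] CE z by blast
  qed
  moreover have "K \<inter> E \<noteq> {}" if "closed K" "connected K" "\<not> bounded K" for K
    using unb that by blast
  ultimately show ?thesis
    unfolding weak_spiders_web_def by blast
qed

section \<open>Continua inside unbounded closed connected sets\<close>

text \<open>\<open>S\<close> is the union of the components of \<open>p\<close> in
  \<open>K \<inter> cball 0 r\<close>. Were it bounded, a component for large \<open>r\<close> would
  stay in the open ball, and boundary bumping would put all of \<open>K\<close> there.\<close>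

lemma unbounded_connected_contains_continua:
  fixes K :: "'a::euclidean_space set"
  assumes "closed K" "connected K" "\<not> bounded K" "p \<in> K"
  obtains S where "S \<subseteq> K" "connected S" "\<not> bounded S"
    "\<And>q. q \<in> S \<Longrightarrow> \<exists>C\<subseteq>K. compact C \<and> connected C \<and> p \<in> C \<and> q \<in> C"
proof -
  define C where "C r = connected_component_set (K \<inter> cball 0 r) p" for r
  have cpt: "compact (K \<inter> cball 0 r)" for r
    using assms(1) by (simp add: closed_Int_compact)
  have C: "C r \<subseteq> K" "compact (C r)" "connected (C r)" "p \<in> C r" "C r \<in> components (K \<inter> cball 0 r)"
    if "r \<ge> norm p" for r
  proof -
    show "C r \<in> components (K \<inter> cball 0 r)"
      using assms(4) that unfolding C_def components_def by auto
    then show "C r \<subseteq> K" "compact (C r)" "connected (C r)"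
      using in_components_subset in_components_connected compact_components cpt by blast+
    show "p \<in> C r"
      using assms(4) that unfolding C_def by auto
  qed
  define S where "S = (\<Union>r\<in>{norm p..}. C r)"
  show ?thesis
  proof
    show "S \<subseteq> K"
      unfolding S_def using C by auto
    show "connected S"
      unfolding S_def by (rule connected_Union) (use C(3,4) in blast)+
    show "\<exists>D\<subseteq>K. compact D \<and> connected D \<and> p \<in> D \<and> q \<in> D" if q: "q \<in> S" for q
    proof -
      obtain r where "r \<ge> norm p" "q \<in> C r"
        using q unfolding S_def by auto
      then show ?thesis
        using C[of r] by blast
    qed
    show "\<not> bounded S"
    proof
      assume "bounded S"
      then obtain b where b: "\<And>x. x \<in> S \<Longrightarrow> norm x \<le> b"
        unfolding bounded_iff by blast
      define r where "r = max (norm p) (b + 1)"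
      have "C r \<subseteq> S"
        unfolding S_def r_def by (intro UN_upper) auto
      then have "C r \<subseteq> ball 0 r"
        using b unfolding r_def by (force simp: subset_iff)
      then have "K \<subseteq> ball 0 r"
        by (intro component_boundary_bumping[OF assms(2) cpt _ _ C(5)]) (auto simp: r_def)
      then show False
        using assms(3) bounded_subset bounded_ball by blast
    qed
  qed
qed

section \<open>The minimum modulus along the orbit of an admissible radius\<close>

text \<open>Trades the increasing sequence for "infinitely many \<open>n\<close>", the form that
  \<open>crossing\<close> delivers. The shift \<open>c\<close> is the order of the preimage.\<close>

lemma V_plus_iff:
  "z \<in> V_plus f R \<longleftrightarrow>
     (\<exists>c. \<forall>M. \<exists>n\<ge>M. (max_min_modulus f ^^ n) R \<le> norm ((f ^^ (n + c)) z))"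
  (is "_ \<longleftrightarrow> (\<exists>c. ?often c)")
proof -
  have "(f ^^ c) z \<in> V_plus_R f R \<longleftrightarrow> ?often c" for c
  proof
    assume "(f ^^ c) z \<in> V_plus_R f R"
    then obtain r :: "nat \<Rightarrow> nat" where r: "strict_mono r"
        "\<forall>j. (max_min_modulus f ^^ r j) R \<le> norm ((f ^^ r j) ((f ^^ c) z))"
      unfolding V_plus_R_def by auto
    then show "?often c"
      by (metis comp_apply funpow_add strict_mono_imp_increasing)
  next
    assume often: "?often c"
    \<comment> \<open>The times must be positive in \<open>V_plus_R\<close>; discarding
      \<open>0\<close> leaves the set infinite.\<close>
    define S where "S = {n. n > 0 \<and> (max_min_modulus f ^^ n) R \<le> norm ((f ^^ (n + c)) z)}"
    have "infinite S"
      unfolding infinite_nat_iff_unbounded_le S_def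
      using often by (metis (mono_tags, lifting) Suc_le_lessD less_imp_le mem_Collect_eq
          less_nat_zero_code neq0_conv le_less_trans not_less_eq_eq)
    then obtain r :: "nat \<Rightarrow> nat" where "strict_mono r" "\<forall>j. r j \<in> S"
      using infinite_enumerate by blast
    then show "(f ^^ c) z \<in> V_plus_R f R"
      unfolding V_plus_R_def S_def by (auto simp: funpow_add intro!: exI[of _ r])
  qed
  then show ?thesis
    unfolding V_plus_def by auto
qed

lemma min_modulus_le:
  assumes "continuous_on UNIV f"
  shows "min_modulus f (norm z) \<le> norm (f z)"
  using min_modulus_attained[OF assms, of "norm z"] by force

locale admissible =
  fixes f :: "complex \<Rightarrow> complex" and R :: real
  assumes hol: "f holomorphic_on UNIV" and adm: "admissible_radius f R"
begin

definition a :: "nat \<Rightarrow> real" where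
  "a n = (max_min_modulus f ^^ n) R"

lemma contf: "continuous_on UNIV f"
  using hol holomorphic_on_imp_continuous_on by blast

lemma hol_funpow: "(f ^^ n) holomorphic_on UNIV"
proof (induction n)
  case (Suc n)
  then show ?case
    using holomorphic_on_compose[of "f ^^ n" UNIV f] holomorphic_on_subset[OF hol]
    by (simp add: o_def)
qed (auto simp: id_def)

lemma cont_funpow: "continuous_on S (f ^^ n)"
  using hol_funpow holomorphic_on_imp_continuous_on continuous_on_subset by blast

lemma a_ge: "a n \<ge> R" and a_less_Suc: "a n < a (Suc n)"
proof -
  have *: "a n \<ge> R" for n
    by (induction n) (use adm in \<open>auto simp: a_def admissible_radius_def intro: less_imp_le\<close>)
  then show "a n \<ge> R" "a n < a (Suc n)"
    using adm by (auto simp: a_def admissible_radius_def)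
qed

lemma a_pos: "a n > 0"
  using a_ge[of n] adm unfolding admissible_radius_def by linarith

lemma a_mono: "m \<le> n \<Longrightarrow> a m \<le> a n"
  using lift_Suc_mono_le[of a] a_less_Suc less_imp_le by blast

text \<open>The radius \<open>s\<close> attains the maximum of \<open>min_modulus f\<close> on
  \<open>{0..a (Suc n)}\<close>, which is \<open>a (Suc (Suc n))\<close>. On \<open>{0..a n}\<close>
  the values are at most \<open>a (Suc n)\<close>, so \<open>s\<close> lies beyond.\<close>

lemma min_modulus_between:
  obtains s where "a n \<le> s" "s \<le> a (Suc n)" "min_modulus f s = a (Suc (Suc n))"
proof -
  obtain s where s: "s \<in> {0..a (Suc n)}" "max_min_modulus f (a (Suc n)) = min_modulus f s"
    using max_min_modulus_attained[OF contf, of "a (Suc n)"] a_pos less_imp_le by blast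
  have eq: "min_modulus f s = a (Suc (Suc n))"
    using s by (simp add: a_def)
  have "a n \<le> s"
  proof (rule ccontr)
    assume "\<not> a n \<le> s"
    then have "s \<in> {0..a n}"
      using s by auto
    then have "min_modulus f s \<le> max_min_modulus f (a n)"
      using max_min_modulus_attained[OF contf, of "a n"] a_pos[of n] by (metis less_imp_le)
    then show False
      using eq a_less_Suc[of "Suc n"] by (simp add: a_def)
  qed
  then show ?thesis
    using that s eq by auto
qed

text \<open>If \<open>a\<close> converged to \<open>L\<close>, the radii from
  \<open>min_modulus_between\<close> would too, so \<open>min_modulus f L = L\<close> by continuity.
  But admissibility gives a value above \<open>L\<close> on \<open>{0..L}\<close>, hence at some
  \<open>t < L\<close>; then \<open>t < a n\<close> for some \<open>n\<close>, which makes
  \<open>a (Suc n)\<close> exceed \<open>L\<close>.\<close>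

lemma a_at_top: "filterlim a at_top sequentially"
proof -
  have "\<not> bdd_above (range a)"
  proof
    assume bdd: "bdd_above (range a)"
    define L where "L = (SUP n. a n)"
    have lim: "a \<longlonglongrightarrow> L"
      unfolding L_def using bdd a_mono by (intro LIMSEQ_incseq_SUP) (auto simp: incseq_def)
    have leL: "a n < L" for n
      using a_less_Suc[of n] cSUP_upper[OF _ bdd, of "Suc n"] unfolding L_def by auto
    have L: "L \<ge> R" "L > 0"
      using leL[of 0] a_ge[of 0] a_pos[of 0] by linarith+
    have "\<forall>n. \<exists>s. a n \<le> s \<and> s \<le> a (Suc n) \<and> min_modulus f s = a (Suc (Suc n))"
      using min_modulus_between by blast
    then obtain s where s: "\<And>n. a n \<le> s n" "\<And>n. s n \<le> a (Suc n)"
        "\<And>n. min_modulus f (s n) = a (Suc (Suc n))"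
      by metis
    have "s \<longlonglongrightarrow> L"
      by (rule tendsto_sandwich[OF _ _ lim LIMSEQ_Suc[OF lim]]) (use s in auto)
    moreover have "s n \<ge> 0" for n
      using s(1)[of n] a_pos[of n] by linarith
    ultimately have "(\<lambda>n. min_modulus f (s n)) \<longlonglongrightarrow> min_modulus f L"
      using L by (intro continuous_on_tendsto_compose[OF continuous_on_min_modulus[OF contf]]) auto
    moreover have "(\<lambda>n. min_modulus f (s n)) \<longlonglongrightarrow> L"
      unfolding s(3) using LIMSEQ_Suc[OF LIMSEQ_Suc[OF lim]] .
    ultimately have mL: "min_modulus f L = L"
      using LIMSEQ_unique by blast
    obtain t where t: "t \<in> {0..L}" "max_min_modulus f L = min_modulus f t"
      using max_min_modulus_attained[OF contf, of L] L by auto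
    have "min_modulus f t > L"
      using t L adm unfolding admissible_radius_def by auto
    then have "t < L"
      using t mL by (metis atLeastAtMost_iff less_irrefl order_le_imp_less_or_eq)
    then obtain n where "t < a n"
      using order_tendstoD(1)[OF lim] by (metis eventually_happens sequentially_bot)
    then have "min_modulus f t \<le> max_min_modulus f (a n)"
      using max_min_modulus_attained[OF contf, of "a n"] a_pos[of n] t
      by (metis atLeastAtMost_iff less_imp_le)
    then show False
      using leL[of "Suc n"] \<open>min_modulus f t > L\<close> by (simp add: a_def)
  qed
  then show ?thesis
    unfolding filterlim_at_top eventually_sequentially bdd_above_def
    by (metis a_mono nle_le order_trans rangeE)
qed

lemma a_gt: "\<exists>n\<ge>M. a n > B"
proof -
  have "eventually (\<lambda>n. a n > B \<and> n \<ge> M) sequentially"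
    using a_at_top by (auto simp: filterlim_at_top_dense eventually_ge_at_top intro: eventually_conj)
  then show ?thesis
    using eventually_happens by fastforce
qed

section \<open>Continua that meet \<open>V_plus\<close>\<close>

text \<open>By the intermediate value theorem the image of \<open>C\<close> meets the circle of
  radius \<open>s\<close> from \<open>min_modulus_between\<close>, and one more application of
  \<open>f\<close> reaches modulus \<open>a (Suc (Suc n))\<close>.\<close>

lemma crossing_funpow: "crossing (\<lambda>n z. norm ((f ^^ (n + c)) z)) a"
proof
  show "continuous_on UNIV (\<lambda>z. norm ((f ^^ (n + c)) z))" for n
    by (intro continuous_on_norm cont_funpow)
  show "a n < a (Suc n)" for n
    by (rule a_less_Suc)
  fix n C
  assume C: "connected C" "\<exists>x\<in>C. norm ((f ^^ (n + c)) x) \<le> a n"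
    "\<exists>x\<in>C. a (Suc n) \<le> norm ((f ^^ (n + c)) x)"
  obtain s where s: "a n \<le> s" "s \<le> a (Suc n)" "min_modulus f s = a (Suc (Suc n))"
    using min_modulus_between by blast
  have "connected ((\<lambda>x. norm ((f ^^ (n + c)) x)) ` C)"
    by (intro connected_continuous_image continuous_on_norm cont_funpow C(1))
  then have "s \<in> (\<lambda>x. norm ((f ^^ (n + c)) x)) ` C"
    using C(2,3) s connected_contains_Icc by (smt (verit) atLeastAtMost_iff image_eqI subsetD)
  then obtain x where "x \<in> C" "s = norm ((f ^^ (n + c)) x)"
    by blast
  then show "\<exists>x\<in>C. a (Suc (Suc n)) \<le> norm ((f ^^ (Suc n + c)) x)"
    using min_modulus_le[OF contf, of "(f ^^ (n + c)) x"] s by auto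
qed

lemma V_plus_iff_a: "z \<in> V_plus f R \<longleftrightarrow> (\<exists>c. \<forall>M. \<exists>n\<ge>M. a n \<le> norm ((f ^^ (n + c)) z))"
  unfolding V_plus_iff a_def ..

lemma continuum_meets_V_plus:
  assumes "compact C" "connected C" "p \<in> C" "\<And>n. n \<ge> N \<Longrightarrow> norm ((f ^^ (n + c)) p) \<le> a n"
    and "q \<in> C" "norm ((f ^^ (N + c)) q) \<ge> a (Suc N)"
  shows "C \<inter> V_plus f R \<noteq> {}"
  using crossing.continuum_frequently[OF crossing_funpow assms] V_plus_iff_a by blast

lemma V_plus_subset_I_plus: "V_plus f R \<subseteq> I_plus f"
proof
  fix z assume "z \<in> V_plus f R"
  then obtain c where c: "\<And>M. \<exists>n\<ge>M. a n \<le> norm ((f ^^ (n + c)) z)"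
    unfolding V_plus_iff_a by blast
  have "\<not> bounded (range (\<lambda>n. (f ^^ n) z))"
  proof
    assume "bounded (range (\<lambda>n. (f ^^ n) z))"
    then obtain B where B: "\<And>n. norm ((f ^^ n) z) \<le> B"
      unfolding bounded_iff by auto
    obtain M where "a M > B"
      using a_gt by blast
    then show False
      using c[of M] B a_mono by (meson not_le order_less_le_trans order_trans)
  qed
  then show "z \<in> I_plus f"
    unfolding I_plus_def by simp
qed

text \<open>Membership fails for every shift, so the caller may choose \<open>c\<close>.\<close>

lemma not_V_plusD:
  assumes "z \<notin> V_plus f R"
  obtains N where "\<And>n. n \<ge> N \<Longrightarrow> norm ((f ^^ (n + c)) z) \<le> a n"
  using assms unfolding V_plus_iff_a by (meson nle_le)

section \<open>Unbounded closed connected sets\<close>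

text \<open>\<open>S\<close> meets circles on which the minimum modulus of \<open>f\<close> is
  arbitrarily large.\<close>

lemma unbounded_connected_image:
  assumes "connected S" "\<not> bounded S"
  shows "\<not> bounded (f ` S)"
proof
  assume "bounded (f ` S)"
  then obtain B where B: "\<And>x. x \<in> S \<Longrightarrow> norm (f x) \<le> B"
    unfolding bounded_iff by auto
  obtain p where p: "p \<in> S"
    using assms by fastforce
  obtain n where n: "a n > max B (norm p)"
    using a_gt by blast
  obtain s where s: "a n \<le> s" "s \<le> a (Suc n)" "min_modulus f s = a (Suc (Suc n))"
    using min_modulus_between by blast
  obtain q where q: "q \<in> S" "norm q > s"
    using assms(2) unfolding bounded_iff by (meson not_le)
  have "connected (norm ` S)"
    by (intro connected_continuous_image assms continuous_intros)
  then have "s \<in> norm ` S"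
    using connected_contains_Icc[of "norm ` S" "norm p" "norm q"] p q s n by auto
  then obtain x where "x \<in> S" "s = norm x"
    by blast
  then show False
    using min_modulus_le[OF contf, of x] s B[of x] n a_mono[of n "Suc (Suc n)"] by auto
qed

lemma unbounded_connected_funpow_image:
  assumes "connected S" "\<not> bounded S"
  shows "\<not> bounded ((f ^^ n) ` S)"
proof (induction n)
  case (Suc n)
  have "connected ((f ^^ n) ` S)"
    using assms(1) cont_funpow connected_continuous_image by blast
  then show ?case
    using unbounded_connected_image[of "(f ^^ n) ` S"] Suc by (simp add: image_comp o_def)
qed (use assms in simp)

text \<open>A point \<open>p\<close> outside \<open>V_plus f R\<close> is low from some time
  \<open>N\<close> on. The \<open>N\<close>th image of \<open>S\<close> is unbounded and supplies a
  high point \<open>q\<close>; a continuum in \<open>K\<close> joins \<open>p\<close> to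
  \<open>q\<close>.\<close>

lemma unbounded_meets_V_plus:
  assumes K: "closed K" "connected K" "\<not> bounded K"
  shows "K \<inter> V_plus f R \<noteq> {}"
proof
  assume empty: "K \<inter> V_plus f R = {}"
  obtain p where p: "p \<in> K"
    using K by fastforce
  obtain S where S: "connected S" "\<not> bounded S"
      "\<And>q. q \<in> S \<Longrightarrow> \<exists>C\<subseteq>K. compact C \<and> connected C \<and> p \<in> C \<and> q \<in> C"
    using unbounded_connected_contains_continua[OF K p] by metis
  \<comment> \<open>The summand \<open>0\<close> is the shift \<open>c\<close> of
    \<open>continuum_meets_V_plus\<close>.\<close>
  obtain N where N: "\<And>n. n \<ge> N \<Longrightarrow> norm ((f ^^ (n + 0)) p) \<le> a n"
    using not_V_plusD[of p 0] empty p by blast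
  have "\<exists>x\<in>(f ^^ (N + 0)) ` S. norm x \<ge> a (Suc N)"
    using unbounded_connected_funpow_image[OF S(1,2), of "N + 0"] unfolding bounded_iff
    by (meson nle_le)
  then obtain q where q: "q \<in> S" "norm ((f ^^ (N + 0)) q) \<ge> a (Suc N)"
    by blast
  then obtain C where "C \<subseteq> K" "compact C" "connected C" "p \<in> C" "q \<in> C"
    using S(3) by blast
  then show False
    using continuum_meets_V_plus[OF _ _ _ N _ q(2)] empty by blast
qed

section \<open>Separating continua and the maximum principle\<close>

lemma maximum_principle_component:
  assumes "compact C" "G \<in> components (- C)" "bounded G" "z \<in> G"
  obtains q where "q \<in> C" "norm ((f ^^ n) z) \<le> norm ((f ^^ n) q)"
proof -
  have fr: "frontier G \<subseteq> C"
    using frontier_of_components_closed_complement assms compact_imp_closed by blast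
  \<comment> \<open>For empty \<open>C\<close> the only component would be the whole plane, which is
    unbounded.\<close>
  have "C \<noteq> {}"
    using assms(2,3) by (auto simp: components_def not_bounded_UNIV)
  then obtain q where q: "q \<in> C" "\<And>x. x \<in> C \<Longrightarrow> norm ((f ^^ n) x) \<le> norm ((f ^^ n) q)"
    using continuous_attains_sup[OF assms(1), of "\<lambda>x. norm ((f ^^ n) x)"] cont_funpow
      continuous_on_norm by blast
  have "norm ((f ^^ n) z) \<le> norm ((f ^^ n) q)"
    by (rule maximum_modulus_frontier[of _ G])
      (use assms fr q in \<open>auto intro: holomorphic_on_subset[OF hol_funpow] cont_funpow\<close>)
  then show ?thesis
    using that q by blast
qed

lemma weak_spiders_web_V_plus: "weak_spiders_web (V_plus f R)"
proof (rule weak_spiders_webI)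
  fix C G
  assume C: "compact C" "connected C" "G \<in> components (- C)" "bounded G" "G \<inter> V_plus f R \<noteq> {}"
  then obtain z where z: "z \<in> G" "z \<in> V_plus f R"
    by blast
  then obtain c where c: "\<And>M. \<exists>n\<ge>M. a n \<le> norm ((f ^^ (n + c)) z)"
    unfolding V_plus_iff_a by blast
  note z = z(1)
  show "C \<inter> V_plus f R \<noteq> {}"
  proof
    assume empty: "C \<inter> V_plus f R = {}"
    obtain p where p: "p \<in> C"
      using maximum_principle_component[OF C(1,3,4) z] by blast
    \<comment> \<open>The shift is \<open>Suc c\<close> because crossing at time \<open>n\<close>
      asks for the level \<open>a (Suc n)\<close>. With \<open>m = Suc n\<close> the iterate
      \<open>n + Suc c\<close> is \<open>m + c\<close>, the one at which \<open>z\<close> reaches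
      \<open>a m\<close>.\<close>
    obtain N where N: "\<And>n. n \<ge> N \<Longrightarrow> norm ((f ^^ (n + Suc c)) p) \<le> a n"
      using not_V_plusD[of p "Suc c"] empty p by blast
    obtain m where m: "m \<ge> Suc N" "a m \<le> norm ((f ^^ (m + c)) z)"
      using c by blast
    then obtain n where n: "m = Suc n" "n \<ge> N"
      by (metis Suc_le_D Suc_le_mono)
    obtain q where q: "q \<in> C" "norm ((f ^^ (m + c)) z) \<le> norm ((f ^^ (m + c)) q)"
      using maximum_principle_component[OF C(1,3,4) z] by blast
    have "a (Suc n) \<le> norm ((f ^^ (n + Suc c)) q)"
      using m q n by simp
    then show False
      using continuum_meets_V_plus[OF C(1,2) p _ q(1), of n "Suc c"] N n empty by auto
  qed
qed (rule unbounded_meets_V_plus)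

text \<open>A bounded orbit is below \<open>a n\<close> for all large \<open>n\<close>, whatever the
  shift. So if \<open>C\<close> missed \<open>I_plus f\<close>, any of its points would be low, and
  \<open>C\<close> would meet the smaller set \<open>V_plus f R\<close>.\<close>

lemma weak_spiders_web_I_plus: "weak_spiders_web (I_plus f)"
proof (rule weak_spiders_webI)
  fix K :: "complex set" assume "closed K" "connected K" "\<not> bounded K"
  then show "K \<inter> I_plus f \<noteq> {}"
    using unbounded_meets_V_plus V_plus_subset_I_plus by blast
next
  fix C G
  assume C: "compact C" "connected C" "G \<in> components (- C)" "bounded G" "G \<inter> I_plus f \<noteq> {}"
  then obtain z where z: "z \<in> G" and unb: "\<not> bounded (range (\<lambda>n. (f ^^ n) z))"
    unfolding I_plus_def by blast
  show "C \<inter> I_plus f \<noteq> {}"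
  proof
    assume empty: "C \<inter> I_plus f = {}"
    obtain p where p: "p \<in> C"
      using maximum_principle_component[OF C(1,3,4) z] by blast
    then obtain B where B: "\<And>n. norm ((f ^^ n) p) \<le> B"
      using empty unfolding I_plus_def bounded_iff by blast
    obtain N where N: "a N > B"
      using a_gt by blast
    \<comment> \<open>The first \<open>N\<close> points of the orbit form a bounded set, so the
      large values occur at times \<open>m \<ge> N\<close>. The difference \<open>m - N\<close>
      becomes the shift \<open>c\<close>.\<close>
    have "\<exists>m\<ge>N. a (Suc N) \<le> norm ((f ^^ m) z)"
    proof (rule ccontr)
      assume "\<not> ?thesis"
      then have "(f ^^ m) z \<in> (\<lambda>n. (f ^^ n) z) ` {..<N} \<union> cball 0 (a (Suc N))" for m
        by (cases "m < N") (auto simp: not_le not_less intro: less_imp_le)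
      then have "range (\<lambda>n. (f ^^ n) z) \<subseteq> (\<lambda>n. (f ^^ n) z) ` {..<N} \<union> cball 0 (a (Suc N))"
        by blast
      then show False
        using unb bounded_subset by (metis bounded_Un bounded_cball finite_imageI
            finite_imp_bounded finite_lessThan)
    qed
    then obtain c where c: "a (Suc N) \<le> norm ((f ^^ (N + c)) z)"
      by (metis le_Suc_ex)
    obtain q where q: "q \<in> C" "norm ((f ^^ (N + c)) z) \<le> norm ((f ^^ (N + c)) q)"
      using maximum_principle_component[OF C(1,3,4) z] by blast
    have "norm ((f ^^ (n + c)) p) \<le> a n" if "n \<ge> N" for n
      using B[of "n + c"] N a_mono[OF that] by linarith
    then have "C \<inter> V_plus f R \<noteq> {}"
      using continuum_meets_V_plus[OF C(1,2) p _ q(1), of N c] c q by auto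
    then show False
      using V_plus_subset_I_plus empty by blast
  qed
qed

end

theorem theorem1p5:
  fixes f :: "complex \<Rightarrow> complex"
  assumes "transcendental_entire f"
    and "\<exists>r>0. filterlim (\<lambda>n. (min_modulus f ^^ n) r) at_top sequentially"
  shows "(\<forall>R. admissible_radius f R \<longrightarrow> weak_spiders_web (V_plus f R)) \<and>
         weak_spiders_web (I_plus f)"
proof -
  have hol: "f holomorphic_on UNIV"
    using assms(1) unfolding transcendental_entire_def by blast
  \<comment> \<open>\<open>I_plus f\<close> mentions no radius, but its proof takes place in
    \<open>admissible\<close>; the hypothesis on the orbit of \<open>r\<close> supplies one.\<close>
  then obtain R where "admissible_radius f R"
    using ex_admissible_radius holomorphic_on_imp_continuous_on assms(2) by blast
  then show ?thesis
    using admissible.weak_spiders_web_V_plus admissible.weak_spiders_web_I_plus hol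
    unfolding admissible_def by blast
qed

end
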